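(* Let $(\gamma,\nu_1,\nu_2):I\to\mathbb{R}^3\times\Delta$ be a framed curve with curvature $(\ell,m,n,\alpha)$. Then $(\gamma,\nu_1,\nu_2)$ is a $(\mu,\nu_1,\overline{\mu})$-Bertrand framed curve if and only if there exists a smooth map $(\lambda,\eta):I\to\mathbb{R}^2$ with $(\lambda,\eta)\not\equiv(0,0)$ such that $$-\lambda(t)m(t)+\dot\eta(t)=0,\qquad \alpha(t)+\dot\lambda(t)+\eta(t)m(t)=0$$ for all $t\in I$.
   Context: All maps are $C^\infty$; $I\subset\mathbb{R}$ is an interval. Let $\Delta=\{(a,b)\in S^2\times S^2\mid a\cdot b=0\}$. A smooth map $(\gamma,\nu_1,\nu_2):I\to\mathbb{R}^3\times\Delta$ is a framed curve if $\dot\gamma(t)\cdot\nu_1(t)=\dot\gamma(t)\cdot\nu_2(t)=0$ for all $t\in I$ ($\gamma$ may have singular points). Put $\mu=\nu_1\times\nu_2$. The curvature $(\ell,m,n,\alpha)$ of the framed curve is $\ell=\dot\nu_1\cdot\nu_2$, $m=\dot\nu_1\cdot\mu$, $n=\dot\nu_2\cdot\mu$, $\alpha=\dot\gamma\cdot\mu$; thus $\dot\gamma=\alpha\mu$. For a second framed curve $(\overline\gamma,\overline\nu_1,\overline\nu_2)$, put $\overline\mu=\overline\nu_1\times\overline\nu_2$. For $v,w,x\in\{\nu_1,\nu_2,\mu\}$, framed curves $(\gamma,\nu_1,\nu_2)$ and $(\overline\gamma,\overline\nu_1,\overline\nu_2)$ are $(v,w,\overline x)$-mates if there exists a smooth map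 $(\lambda,\eta):I\to\mathbb{R}^2$ with $(\lambda,\eta)\not\equiv(0,0)$ such that $\overline\gamma(t)=\gamma(t)+\lambda(t)v(t)+\eta(t)w(t)$ and $v(t)\times w(t)=\overline x(t)$ for all $t\in I$. $(\gamma,\nu_1,\nu_2)$ is a $(v,w,\overline x)$-Bertrand framed curve if there exists a framed curve $(\overline\gamma,\overline\nu_1,\overline\nu_2)$ such that the two are $(v,w,\overline x)$-mates. Here $(\lambda,\eta)\not\equiv(0,0)$ means that $(\lambda,\eta)$ is not identically zero on any non-trivial subinterval of $I$. *)

theory Defs
  imports "HOL-Analysis.Analysis"
begin

text \<open>
  Maps on an interval \<open>I\<close> are total functions on \<open>real\<close> of which only the values on \<open>I\<close> matter.
  Derivatives are taken within \<open>I\<close>, hence are one-sided at an endpoint belonging to \<open>I\<close>;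
  this requires \<open>I\<close> to be non-degenerate.
\<close>

definition nontrivial_interval :: "real set \<Rightarrow> bool" where
  "nontrivial_interval I \<longleftrightarrow> is_interval I \<and> interior I \<noteq> {}"

definition deriv_on :: "real set \<Rightarrow> (real \<Rightarrow> 'a::real_normed_vector) \<Rightarrow> real \<Rightarrow> 'a" where
  "deriv_on I f t = vector_derivative f (at t within I)"

text \<open>\<open>F k\<close> is the \<open>k\<close>-th derivative of \<open>f\<close>.\<close>

definition smooth_on :: "real set \<Rightarrow> (real \<Rightarrow> 'a::real_normed_vector) \<Rightarrow> bool" where
  "smooth_on I f \<longleftrightarrow> (\<exists>F :: nat \<Rightarrow> real \<Rightarrow> 'a.
     (\<forall>t\<in>I. F 0 t = f t) \<and>
     (\<forall>k. \<forall>t\<in>I. (F k has_vector_derivative F (Suc k) t) (at t within I)))"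

definition Delta :: "((real^3) \<times> (real^3)) set" where
  "Delta = {(a, b). a \<in> sphere 0 1 \<and> b \<in> sphere 0 1 \<and> a \<bullet> b = 0}"

definition framed_curve ::
  "real set \<Rightarrow> (real \<Rightarrow> real^3) \<Rightarrow> (real \<Rightarrow> real^3) \<Rightarrow> (real \<Rightarrow> real^3) \<Rightarrow> bool" where
  "framed_curve I \<gamma> \<nu>1 \<nu>2 \<longleftrightarrow>
     smooth_on I (\<lambda>t. (\<gamma> t, \<nu>1 t, \<nu>2 t)) \<and>
     (\<forall>t\<in>I. (\<nu>1 t, \<nu>2 t) \<in> Delta) \<and>
     (\<forall>t\<in>I. deriv_on I \<gamma> t \<bullet> \<nu>1 t = 0 \<and> deriv_on I \<gamma> t \<bullet> \<nu>2 t = 0)"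

definition frame_mu :: "(real \<Rightarrow> real^3) \<Rightarrow> (real \<Rightarrow> real^3) \<Rightarrow> real \<Rightarrow> real^3" where
  "frame_mu \<nu>1 \<nu>2 t = cross3 (\<nu>1 t) (\<nu>2 t)"

text \<open>The quadruple \<open>(\<ell>, m, n, \<alpha>)\<close> at the parameter \<open>t\<close>.\<close>

definition curvature ::
  "real set \<Rightarrow> (real \<Rightarrow> real^3) \<Rightarrow> (real \<Rightarrow> real^3) \<Rightarrow> (real \<Rightarrow> real^3) \<Rightarrow>
   real \<Rightarrow> real \<times> real \<times> real \<times> real" where
  "curvature I \<gamma> \<nu>1 \<nu>2 t =
     (deriv_on I \<nu>1 t \<bullet> \<nu>2 t,
      deriv_on I \<nu>1 t \<bullet> frame_mu \<nu>1 \<nu>2 t,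
      deriv_on I \<nu>2 t \<bullet> frame_mu \<nu>1 \<nu>2 t,
      deriv_on I \<gamma> t \<bullet> frame_mu \<nu>1 \<nu>2 t)"

text \<open>
  The condition written \<open>f \<not>\<equiv> 0\<close>: it says that \<open>f\<close> does not vanish identically on any
  non-trivial subinterval, which is stronger than \<open>f\<close> not being the zero function on \<open>I\<close>.
\<close>

definition nowhere_identically_zero :: "real set \<Rightarrow> (real \<Rightarrow> 'a::zero) \<Rightarrow> bool" where
  "nowhere_identically_zero I f \<longleftrightarrow>
     (\<forall>J. J \<subseteq> I \<and> nontrivial_interval J \<longrightarrow> (\<exists>t\<in>J. f t \<noteq> 0))"

text \<open>
  The symbols \<open>\<nu>\<^sub>1, \<nu>\<^sub>2, \<mu>\<close>, used to name the vectors \<open>v, w, x\<close> of a mate relation: \<open>v\<close> and \<open>w\<close>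
  are read in the frame of the first curve and \<open>x\<close> in the frame of the second.
\<close>

datatype frame_symbol = Nu1 | Nu2 | Mu

fun frame_vector ::
  "frame_symbol \<Rightarrow> (real \<Rightarrow> real^3) \<Rightarrow> (real \<Rightarrow> real^3) \<Rightarrow> real \<Rightarrow> real^3" where
  "frame_vector Nu1 \<nu>1 \<nu>2 t = \<nu>1 t"
| "frame_vector Nu2 \<nu>1 \<nu>2 t = \<nu>2 t"
| "frame_vector Mu \<nu>1 \<nu>2 t = frame_mu \<nu>1 \<nu>2 t"

definition mates ::
  "frame_symbol \<Rightarrow> frame_symbol \<Rightarrow> frame_symbol \<Rightarrow> real set \<Rightarrow>
   (real \<Rightarrow> real^3) \<Rightarrow> (real \<Rightarrow> real^3) \<Rightarrow> (real \<Rightarrow> real^3) \<Rightarrow>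
   (real \<Rightarrow> real^3) \<Rightarrow> (real \<Rightarrow> real^3) \<Rightarrow> (real \<Rightarrow> real^3) \<Rightarrow> bool" where
  "mates v w x I \<gamma> \<nu>1 \<nu>2 \<gamma>' \<nu>1' \<nu>2' \<longleftrightarrow>
     framed_curve I \<gamma> \<nu>1 \<nu>2 \<and> framed_curve I \<gamma>' \<nu>1' \<nu>2' \<and>
     (\<exists>lam \<eta> :: real \<Rightarrow> real.
        smooth_on I (\<lambda>t. (lam t, \<eta> t)) \<and>
        nowhere_identically_zero I (\<lambda>t. (lam t, \<eta> t)) \<and>
        (\<forall>t\<in>I. \<gamma>' t = \<gamma> t + lam t *\<^sub>R frame_vector v \<nu>1 \<nu>2 t + \<eta> t *\<^sub>R frame_vector w \<nu>1 \<nu>2 t \<and>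
          cross3 (frame_vector v \<nu>1 \<nu>2 t) (frame_vector w \<nu>1 \<nu>2 t) = frame_vector x \<nu>1' \<nu>2' t))"

definition Bertrand_framed_curve ::
  "frame_symbol \<Rightarrow> frame_symbol \<Rightarrow> frame_symbol \<Rightarrow> real set \<Rightarrow>
   (real \<Rightarrow> real^3) \<Rightarrow> (real \<Rightarrow> real^3) \<Rightarrow> (real \<Rightarrow> real^3) \<Rightarrow> bool" where
  "Bertrand_framed_curve v w x I \<gamma> \<nu>1 \<nu>2 \<longleftrightarrow>
     (\<exists>\<gamma>' \<nu>1' \<nu>2'. framed_curve I \<gamma>' \<nu>1' \<nu>2' \<and> mates v w x I \<gamma> \<nu>1 \<nu>2 \<gamma>' \<nu>1' \<nu>2')"

end

theory Submission
  imports Defs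
begin

text \<open>
  Let \<open>\<mu>\<close> and \<open>\<mu>'\<close> be the third frame vectors of the two curves. A mate is an offset curve
  \<open>\<gamma>' = \<gamma> + lam \<mu> + \<eta> \<nu>\<^sub>1\<close> with \<open>\<mu>' = \<mu> \<times> \<nu>\<^sub>1 = \<nu>\<^sub>2\<close>, and the velocity of a framed curve is a multiple
  of its own third frame vector. Hence the velocity of \<open>\<gamma>'\<close> points along \<open>\<nu>\<^sub>2\<close>, that is, its
  components along \<open>\<mu>\<close> and \<open>\<nu>\<^sub>1\<close> vanish. These two components are the left sides of the two
  differential equations (\<open>offset_velocity_components\<close>).

  Conversely, the equations say that the curve \<open>\<gamma> + lam \<mu> + \<eta> \<nu>\<^sub>1\<close> has velocity orthogonal to \<open>\<mu>\<close>
  and \<open>\<nu>\<^sub>1\<close>, so \<open>(\<mu>, \<nu>\<^sub>1)\<close> itself frames it, and the third vector of this frame is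
  \<open>\<mu> \<times> \<nu>\<^sub>1 = \<nu>\<^sub>2\<close>. What remains is that this new curve and frame are smooth, which rests on the
  closure of smooth maps under bounded bilinear operations (\<open>smooth_on_bilinear\<close>).
\<close>

section \<open>Derivatives within an interval\<close>

lemma nontrivial_interval_not_bot:
  assumes "nontrivial_interval I" "t \<in> I"
  shows "at t within I \<noteq> bot"
proof -
  have "connected I"
    using assms(1) by (simp add: nontrivial_interval_def is_interval_connected)
  moreover have "I \<noteq> {x}" for x
    using assms(1) by (auto simp: nontrivial_interval_def)
  ultimately show ?thesis
    using connected_imp_perfect[of I t] assms(2) by (simp add: trivial_limit_within)
qed

lemma deriv_on_eqI:
  assumes "nontrivial_interval I" "t \<in> I" "(f has_vector_derivative f') (at t within I)"
  shows "deriv_on I f t = f'"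
  unfolding deriv_on_def
  using vector_derivative_within[OF nontrivial_interval_not_bot[OF assms(1,2)] assms(3)] .

lemma smooth_on_has_deriv_on:
  assumes "smooth_on I f" "t \<in> I"
  shows "(f has_vector_derivative deriv_on I f t) (at t within I)"
proof -
  obtain F where F: "\<And>t. t \<in> I \<Longrightarrow> F 0 t = f t"
    "\<And>k t. t \<in> I \<Longrightarrow> (F k has_vector_derivative F (Suc k) t) (at t within I)"
    using assms(1) unfolding smooth_on_def by blast
  have "(f has_vector_derivative F (Suc 0) t) (at t within I)"
    by (rule has_vector_derivative_transform[OF assms(2) _ F(2)[OF assms(2)]]) (simp add: F(1))
  then show ?thesis
    unfolding deriv_on_def using differentiableI_vector vector_derivative_works by blast
qed

lemma deriv_on_cong:
  assumes I: "nontrivial_interval I" and t: "t \<in> I"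
    and f: "smooth_on I f" and eq: "\<And>s. s \<in> I \<Longrightarrow> g s = f s"
  shows "deriv_on I g t = deriv_on I f t"
  by (rule deriv_on_eqI[OF I t],
      rule has_vector_derivative_transform[OF t eq smooth_on_has_deriv_on[OF f t]])

text \<open>The product rule applied to a constant inner product; with \<open>f = g\<close> it says that a vector
  of constant length is orthogonal to its derivative.\<close>

lemma deriv_on_inner_const:
  assumes I: "nontrivial_interval I" and t: "t \<in> I"
    and f: "smooth_on I f" and g: "smooth_on I g"
    and const: "\<And>s. s \<in> I \<Longrightarrow> f s \<bullet> g s = c"
  shows "deriv_on I f t \<bullet> g t + f t \<bullet> deriv_on I g t = 0"
proof -
  have "((\<lambda>s. f s \<bullet> g s) has_vector_derivative
      f t \<bullet> deriv_on I g t + deriv_on I f t \<bullet> g t) (at t within I)"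
    by (rule bounded_bilinear.has_vector_derivative[OF bounded_bilinear_inner
          smooth_on_has_deriv_on[OF f t] smooth_on_has_deriv_on[OF g t]])
  moreover have "((\<lambda>s. f s \<bullet> g s) has_vector_derivative 0) (at t within I)"
    by (rule has_vector_derivative_transform[OF t const has_vector_derivative_const])
  ultimately show ?thesis
    using vector_derivative_unique_within[OF nontrivial_interval_not_bot[OF I t]]
    by (metis add.commute)
qed

section \<open>Closure properties of smooth maps\<close>

lemma smooth_on_bounded_linear:
  assumes "bounded_linear h" "smooth_on I f"
  shows "smooth_on I (\<lambda>t. h (f t))"
proof -
  obtain F where "\<forall>t\<in>I. F 0 t = f t"
    "\<forall>k. \<forall>t\<in>I. (F k has_vector_derivative F (Suc k) t) (at t within I)"
    using assms(2) unfolding smooth_on_def by blast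
  then show ?thesis
    unfolding smooth_on_def using bounded_linear.has_vector_derivative[OF assms(1)]
    by (intro exI[of _ "\<lambda>k t. h (F k t)"]) auto
qed

lemma smooth_on_Pair:
  assumes "smooth_on I f" "smooth_on I g"
  shows "smooth_on I (\<lambda>t. (f t, g t))"
proof -
  obtain F G where "\<forall>t\<in>I. F 0 t = f t" "\<forall>t\<in>I. G 0 t = g t"
    "\<forall>k. \<forall>t\<in>I. (F k has_vector_derivative F (Suc k) t) (at t within I)"
    "\<forall>k. \<forall>t\<in>I. (G k has_vector_derivative G (Suc k) t) (at t within I)"
    using assms unfolding smooth_on_def by blast
  then show ?thesis
    unfolding smooth_on_def
    by (intro exI[of _ "\<lambda>k t. (F k t, G k t)"]) (auto intro!: has_vector_derivative_Pair)
qed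

lemma smooth_on_PairD:
  assumes "smooth_on I (\<lambda>t. (f t, g t))"
  shows "smooth_on I f" "smooth_on I g"
  using smooth_on_bounded_linear[OF bounded_linear_fst assms]
    smooth_on_bounded_linear[OF bounded_linear_snd assms] by simp_all

lemma smooth_on_add:
  assumes "smooth_on I f" "smooth_on I g"
  shows "smooth_on I (\<lambda>t. f t + g t)"
  using smooth_on_bounded_linear[OF bounded_linear_add[OF bounded_linear_fst bounded_linear_snd]
      smooth_on_Pair[OF assms]] by simp

text \<open>
  The \<open>k\<close>-th derivative of \<open>B (F i) (G j)\<close> when \<open>F\<close> and \<open>G\<close> list successive derivatives.
  Keeping \<open>i\<close> and \<open>j\<close> as arguments gives the recursion a Pascal-triangle form, in which the
  Leibniz rule needs no binomial coefficients.
\<close>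

fun leibniz :: "('a \<Rightarrow> 'b \<Rightarrow> 'c::plus) \<Rightarrow> (nat \<Rightarrow> real \<Rightarrow> 'a) \<Rightarrow> (nat \<Rightarrow> real \<Rightarrow> 'b) \<Rightarrow>
    nat \<Rightarrow> nat \<Rightarrow> nat \<Rightarrow> real \<Rightarrow> 'c" where
  "leibniz B F G 0 i j t = B (F i t) (G j t)"
| "leibniz B F G (Suc k) i j t = leibniz B F G k i (Suc j) t + leibniz B F G k (Suc i) j t"

lemma smooth_on_bilinear:
  assumes B: "bounded_bilinear B" and "smooth_on I f" "smooth_on I g"
  shows "smooth_on I (\<lambda>t. B (f t) (g t))"
proof -
  obtain F G where "\<forall>t\<in>I. F 0 t = f t" "\<forall>t\<in>I. G 0 t = g t"
    and F: "\<forall>k. \<forall>t\<in>I. (F k has_vector_derivative F (Suc k) t) (at t within I)"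
    and G: "\<forall>k. \<forall>t\<in>I. (G k has_vector_derivative G (Suc k) t) (at t within I)"
    using assms unfolding smooth_on_def by blast
  moreover have "(leibniz B F G k i j has_vector_derivative leibniz B F G (Suc k) i j t)
      (at t within I)" if "t \<in> I" for k i j t
  proof (induction k arbitrary: i j)
    case 0
    show ?case
      using bounded_bilinear.has_vector_derivative[OF B F[rule_format, OF that]
          G[rule_format, OF that]] by simp
  next
    case (Suc k)
    show ?case
      using has_vector_derivative_add[OF Suc.IH[of i "Suc j"] Suc.IH[of "Suc i" j]] by simp
  qed
  ultimately show ?thesis
    unfolding smooth_on_def by (intro exI[of _ "\<lambda>k. leibniz B F G k 0 0"]) simp
qed

lemma smooth_on_frame_mu:
  assumes "smooth_on I \<nu>1" "smooth_on I \<nu>2"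
  shows "smooth_on I (frame_mu \<nu>1 \<nu>2)"
proof -
  have "bounded_bilinear cross3"
    using bilinear_cross by (simp add: bilinear_conv_bounded_bilinear)
  from smooth_on_bilinear[OF this assms] show ?thesis
    by (simp add: frame_mu_def[abs_def])
qed

section \<open>Orthonormal frames\<close>

lemma framed_curve_smooth:
  assumes "framed_curve I \<gamma> \<nu>1 \<nu>2"
  shows "smooth_on I \<gamma>" "smooth_on I \<nu>1" "smooth_on I \<nu>2" "smooth_on I (frame_mu \<nu>1 \<nu>2)"
proof -
  have "smooth_on I (\<lambda>t. (\<gamma> t, \<nu>1 t, \<nu>2 t))"
    using assms by (simp add: framed_curve_def)
  note * = smooth_on_PairD[OF this]
  show "smooth_on I \<gamma>" "smooth_on I \<nu>1" "smooth_on I \<nu>2"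
    using * smooth_on_PairD[OF *(2)] by auto
  then show "smooth_on I (frame_mu \<nu>1 \<nu>2)"
    using smooth_on_frame_mu by blast
qed

lemma Delta_iff: "(a, b) \<in> Delta \<longleftrightarrow> a \<bullet> a = 1 \<and> b \<bullet> b = 1 \<and> a \<bullet> b = 0"
  by (simp add: Delta_def norm_eq_1)

lemma Delta_cross:
  assumes "(a, b) \<in> Delta"
  shows "(cross3 a b, a) \<in> Delta" "cross3 (cross3 a b) a = b"
proof -
  have "cross3 a b \<bullet> cross3 a b = (a \<bullet> a) * (b \<bullet> b) - (a \<bullet> b)\<^sup>2"
    using dot_cross[of a b a b] by (simp add: inner_commute power2_eq_square)
  moreover have "cross3 a b \<bullet> a = 0"
    by (simp add: dot_cross_self inner_commute[of _ a])
  ultimately show "(cross3 a b, a) \<in> Delta"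
    using assms by (simp add: Delta_iff)
  show "cross3 (cross3 a b) a = b"
    using assms Lagrange[of a a b] by (simp add: cross_skew[of _ a] Delta_iff)
qed

text \<open>A vector orthogonal to \<open>a\<close> and \<open>b\<close> satisfies \<open>x \<times> (a \<times> b) = 0\<close>; it is thus parallel to
  \<open>a \<times> b\<close> and has no component orthogonal to it.\<close>

lemma inner_eq_0_of_orthogonal_frame:
  fixes x y :: "real^3"
  assumes D: "(a, b) \<in> Delta" and x: "x \<bullet> a = 0" "x \<bullet> b = 0" and y: "y \<bullet> cross3 a b = 0"
  shows "x \<bullet> y = 0"
proof -
  let ?c = "cross3 a b"
  have "cross3 x ?c = 0"
    using Lagrange[of x a b] x by simp
  then have "(x \<bullet> y) * (?c \<bullet> ?c) = 0"
    using dot_cross[of x ?c y ?c] y by (simp add: inner_commute)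
  then show ?thesis
    using Delta_cross(1)[OF D] by (auto simp: Delta_iff)
qed

section \<open>The velocity of an offset curve\<close>

lemma smooth_on_offset:
  assumes fr: "framed_curve I \<gamma> \<nu>1 \<nu>2" and lam: "smooth_on I lam" and \<eta>: "smooth_on I \<eta>"
  shows "smooth_on I (\<lambda>t. \<gamma> t + lam t *\<^sub>R frame_mu \<nu>1 \<nu>2 t + \<eta> t *\<^sub>R \<nu>1 t)"
  by (intro smooth_on_add smooth_on_bilinear[OF bounded_bilinear_scaleR]
      lam \<eta> framed_curve_smooth[OF fr])

text \<open>
  The components come from the Frenet-type relations of the frame: \<open>\<mu>\<close> and \<open>\<nu>\<^sub>1\<close> are orthogonal to
  their own derivatives, and differentiating \<open>\<mu> \<bullet> \<nu>\<^sub>1 = 0\<close> turns the component \<open>m\<close> of the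
  derivative of \<open>\<nu>\<^sub>1\<close> along \<open>\<mu>\<close> into the component \<open>- m\<close> of the derivative of \<open>\<mu>\<close> along \<open>\<nu>\<^sub>1\<close>.
\<close>

lemma offset_velocity_components:
  fixes \<gamma> \<nu>1 \<nu>2 :: "real \<Rightarrow> real^3"
  assumes I: "nontrivial_interval I" and t: "t \<in> I" and fr: "framed_curve I \<gamma> \<nu>1 \<nu>2"
    and curv: "curvature I \<gamma> \<nu>1 \<nu>2 t = (l, m, n, \<alpha>)"
    and lam: "smooth_on I lam" and \<eta>: "smooth_on I \<eta>"
  defines "\<mu> \<equiv> frame_mu \<nu>1 \<nu>2"
  defines "v \<equiv> deriv_on I (\<lambda>t. \<gamma> t + lam t *\<^sub>R \<mu> t + \<eta> t *\<^sub>R \<nu>1 t) t"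
  shows "v \<bullet> \<mu> t = \<alpha> + deriv_on I lam t + \<eta> t * m"
    and "v \<bullet> \<nu>1 t = - lam t * m + deriv_on I \<eta> t"
proof -
  note sm = framed_curve_smooth[OF fr, folded \<mu>_def]
  have orth: "\<mu> s \<bullet> \<mu> s = 1 \<and> \<nu>1 s \<bullet> \<nu>1 s = 1 \<and> \<mu> s \<bullet> \<nu>1 s = 0" if "s \<in> I" for s
    using Delta_cross(1)[of "\<nu>1 s" "\<nu>2 s"] fr that
    by (simp add: framed_curve_def \<mu>_def frame_mu_def Delta_iff)
  have v: "v = deriv_on I \<gamma> t + (lam t *\<^sub>R deriv_on I \<mu> t + deriv_on I lam t *\<^sub>R \<mu> t)
      + (\<eta> t *\<^sub>R deriv_on I \<nu>1 t + deriv_on I \<eta> t *\<^sub>R \<nu>1 t)"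
    unfolding v_def
    by (intro deriv_on_eqI[OF I t] has_vector_derivative_add
        bounded_bilinear.has_vector_derivative[OF bounded_bilinear_scaleR]
        smooth_on_has_deriv_on[OF _ t] sm lam \<eta>)
  have \<mu>\<mu>: "deriv_on I \<mu> t \<bullet> \<mu> t = 0"
    using deriv_on_inner_const[OF I t sm(4) sm(4), of 1] orth by (simp add: inner_commute)
  have \<nu>\<nu>: "deriv_on I \<nu>1 t \<bullet> \<nu>1 t = 0"
    using deriv_on_inner_const[OF I t sm(2) sm(2), of 1] orth by (simp add: inner_commute)
  have m: "deriv_on I \<nu>1 t \<bullet> \<mu> t = m" and \<alpha>: "deriv_on I \<gamma> t \<bullet> \<mu> t = \<alpha>"
    using curv by (simp_all add: curvature_def \<mu>_def)
  have \<mu>\<nu>: "deriv_on I \<mu> t \<bullet> \<nu>1 t = - m"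
    using deriv_on_inner_const[OF I t sm(4) sm(2), of 0] orth m by (simp add: inner_commute)
  have \<gamma>\<nu>: "deriv_on I \<gamma> t \<bullet> \<nu>1 t = 0"
    using fr t by (simp add: framed_curve_def)
  show "v \<bullet> \<mu> t = \<alpha> + deriv_on I lam t + \<eta> t * m"
    using orth[OF t] by (simp add: v inner_add_left \<mu>\<mu> m \<alpha> inner_commute[of "\<nu>1 t" "\<mu> t"])
  show "v \<bullet> \<nu>1 t = - lam t * m + deriv_on I \<eta> t"
    using orth[OF t] by (simp add: v inner_add_left \<nu>\<nu> \<mu>\<nu> \<gamma>\<nu>)
qed

section \<open>Bertrand framed curves and the differential equations\<close>

theorem theorem4p6:
  fixes I :: "real set"
    and \<gamma> \<nu>1 \<nu>2 :: "real \<Rightarrow> real^3"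
    and l m n \<alpha> :: "real \<Rightarrow> real"
  assumes "nontrivial_interval I"
    and "framed_curve I \<gamma> \<nu>1 \<nu>2"
    and "\<forall>t\<in>I. curvature I \<gamma> \<nu>1 \<nu>2 t = (l t, m t, n t, \<alpha> t)"
  shows "Bertrand_framed_curve Mu Nu1 Mu I \<gamma> \<nu>1 \<nu>2 \<longleftrightarrow>
    (\<exists>lam \<eta> :: real \<Rightarrow> real.
       smooth_on I (\<lambda>t. (lam t, \<eta> t)) \<and>
       nowhere_identically_zero I (\<lambda>t. (lam t, \<eta> t)) \<and>
       (\<forall>t\<in>I. - lam t * m t + deriv_on I \<eta> t = 0 \<and>
               \<alpha> t + deriv_on I lam t + \<eta> t * m t = 0))"
proof
  let ?\<mu> = "frame_mu \<nu>1 \<nu>2"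
  assume "Bertrand_framed_curve Mu Nu1 Mu I \<gamma> \<nu>1 \<nu>2"
  then obtain \<gamma>' \<nu>1' \<nu>2' and lam \<eta> :: "real \<Rightarrow> real"
    where fr': "framed_curve I \<gamma>' \<nu>1' \<nu>2'"
      and sm: "smooth_on I (\<lambda>t. (lam t, \<eta> t))"
      and nz: "nowhere_identically_zero I (\<lambda>t. (lam t, \<eta> t))"
      and eq: "\<And>t. t \<in> I \<Longrightarrow> \<gamma>' t = \<gamma> t + lam t *\<^sub>R ?\<mu> t + \<eta> t *\<^sub>R \<nu>1 t"
      and \<mu>': "\<And>t. t \<in> I \<Longrightarrow> cross3 (?\<mu> t) (\<nu>1 t) = cross3 (\<nu>1' t) (\<nu>2' t)"
    unfolding Bertrand_framed_curve_def mates_def by (auto simp: frame_mu_def)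
  note sm' = smooth_on_PairD[OF sm]
  have "- lam t * m t + deriv_on I \<eta> t = 0 \<and> \<alpha> t + deriv_on I lam t + \<eta> t * m t = 0"
    if t: "t \<in> I" for t
  proof -
    have v: "deriv_on I \<gamma>' t =
        deriv_on I (\<lambda>t. \<gamma> t + lam t *\<^sub>R ?\<mu> t + \<eta> t *\<^sub>R \<nu>1 t) t"
      by (rule deriv_on_cong[OF assms(1) t smooth_on_offset[OF assms(2) sm'] eq])
    have D': "(\<nu>1' t, \<nu>2' t) \<in> Delta" "deriv_on I \<gamma>' t \<bullet> \<nu>1' t = 0" "deriv_on I \<gamma>' t \<bullet> \<nu>2' t = 0"
      using fr' t by (auto simp: framed_curve_def)
    have "?\<mu> t \<bullet> cross3 (\<nu>1' t) (\<nu>2' t) = 0" "\<nu>1 t \<bullet> cross3 (\<nu>1' t) (\<nu>2' t) = 0"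
      unfolding \<mu>'[OF t, symmetric] by (simp_all add: dot_cross_self)
    then have "deriv_on I \<gamma>' t \<bullet> ?\<mu> t = 0" "deriv_on I \<gamma>' t \<bullet> \<nu>1 t = 0"
      using inner_eq_0_of_orthogonal_frame[OF D'] by auto
    then show ?thesis
      using offset_velocity_components[OF assms(1) t assms(2) assms(3)[rule_format, OF t] sm']
      unfolding v by simp
  qed
  with sm nz show "\<exists>lam \<eta> :: real \<Rightarrow> real.
       smooth_on I (\<lambda>t. (lam t, \<eta> t)) \<and>
       nowhere_identically_zero I (\<lambda>t. (lam t, \<eta> t)) \<and>
       (\<forall>t\<in>I. - lam t * m t + deriv_on I \<eta> t = 0 \<and>
               \<alpha> t + deriv_on I lam t + \<eta> t * m t = 0)"
    by blast
next
  let ?\<mu> = "frame_mu \<nu>1 \<nu>2"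
  assume "\<exists>lam \<eta> :: real \<Rightarrow> real.
       smooth_on I (\<lambda>t. (lam t, \<eta> t)) \<and>
       nowhere_identically_zero I (\<lambda>t. (lam t, \<eta> t)) \<and>
       (\<forall>t\<in>I. - lam t * m t + deriv_on I \<eta> t = 0 \<and>
               \<alpha> t + deriv_on I lam t + \<eta> t * m t = 0)"
  then obtain lam \<eta> :: "real \<Rightarrow> real"
    where sm: "smooth_on I (\<lambda>t. (lam t, \<eta> t))"
      and nz: "nowhere_identically_zero I (\<lambda>t. (lam t, \<eta> t))"
      and ode: "\<And>t. t \<in> I \<Longrightarrow> - lam t * m t + deriv_on I \<eta> t = 0"
        "\<And>t. t \<in> I \<Longrightarrow> \<alpha> t + deriv_on I lam t + \<eta> t * m t = 0"
    by blast
  note sm' = smooth_on_PairD[OF sm]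
  define \<gamma>' where "\<gamma>' = (\<lambda>t. \<gamma> t + lam t *\<^sub>R ?\<mu> t + \<eta> t *\<^sub>R \<nu>1 t)"
  have D: "(\<nu>1 t, \<nu>2 t) \<in> Delta" if "t \<in> I" for t
    using assms(2) that by (simp add: framed_curve_def)
  have "deriv_on I \<gamma>' t \<bullet> ?\<mu> t = 0 \<and> deriv_on I \<gamma>' t \<bullet> \<nu>1 t = 0" if t: "t \<in> I" for t
    using offset_velocity_components[OF assms(1) t assms(2) assms(3)[rule_format, OF t] sm']
      ode[OF t] unfolding \<gamma>'_def by simp
  moreover have "smooth_on I (\<lambda>t. (\<gamma>' t, ?\<mu> t, \<nu>1 t))"
    unfolding \<gamma>'_def
    by (intro smooth_on_Pair smooth_on_offset[OF assms(2) sm'] framed_curve_smooth[OF assms(2)])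
  ultimately have fr': "framed_curve I \<gamma>' ?\<mu> \<nu>1"
    using Delta_cross(1)[OF D] by (simp add: framed_curve_def frame_mu_def)
  have "mates Mu Nu1 Mu I \<gamma> \<nu>1 \<nu>2 \<gamma>' ?\<mu> \<nu>1"
    unfolding mates_def
    by (intro conjI exI[of _ lam] exI[of _ \<eta>] assms(2) fr' sm nz)
       (simp add: \<gamma>'_def frame_mu_def[of ?\<mu>])
  with fr' show "Bertrand_framed_curve Mu Nu1 Mu I \<gamma> \<nu>1 \<nu>2"
    unfolding Bertrand_framed_curve_def by blast
qed

end
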